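(* Let $d\geqslant 1$. The set $\Lambda^d\subseteq\mathbb{R}^d$ of non-singular frequencies has full Lebesgue measure, i.e. $\mathbb{R}^d\setminus\Lambda^d$ has Lebesgue measure zero.
   Context: For $x\in\mathbb{R}^d$, define $\|x\|_{\mathbb{T}^d,\infty}=\min_{k\in\mathbb{Z}^d}\|x-k\|_\infty$, where $\|\cdot\|_\infty$ is the sup norm. The non-singular frequency set $\Lambda^d\subseteq\mathbb{R}^d$ is the set of all $\alpha=(\alpha_1,\ldots,\alpha_d)\in\mathbb{R}^d$ such that $1,\alpha_1,\ldots,\alpha_d$ are linearly independent over $\mathbb{Q}$ and there exist $c_0>0$ and a sequence of positive integers $N_j\to\infty$ such that, for every $j$, $$\min_{1\leqslant n\leqslant N_j}\|n\alpha\|_{\mathbb{T}^d,\infty}\geqslant c_0N_j^{-1/d}.$$ *)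

theory Defs
  imports "HOL-Analysis.Analysis"
begin

text \<open>
  The infimum over the integer points is a minimum; see the lemma
  \<open>torus_norm_attained\<close> below. The norm \<^const>\<open>infnorm\<close> is the sup norm on
  \<^typ>\<open>real ^ 'd\<close>.
\<close>

definition torus_norm :: "real ^ 'd::finite \<Rightarrow> real" where
  "torus_norm x = Inf {infnorm (x - k) | k. \<forall>i. k $ i \<in> \<int>}"

lemma torus_norm_attained:
  fixes x :: "real ^ 'd::finite"
  shows "\<exists>k. (\<forall>i. k $ i \<in> \<int>) \<and> torus_norm x = infnorm (x - k)"
    and "\<And>k. (\<forall>i. k $ i \<in> \<int>) \<Longrightarrow> torus_norm x \<le> infnorm (x - k)"
proof -
  define k0 :: "real ^ 'd" where "k0 = (\<chi> i. of_int (round (x $ i)))"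
  have k0: "\<forall>i. k0 $ i \<in> \<int>"
    by (simp add: k0_def)
  have min: "infnorm (x - k0) \<le> infnorm (x - k)" if "\<forall>i. k $ i \<in> \<int>" for k
  proof -
    have "\<bar>(x - k0) $ i\<bar> \<le> infnorm (x - k)" for i
    proof -
      obtain m where m: "k $ i = of_int m"
        using \<open>\<forall>i. k $ i \<in> \<int>\<close> Ints_cases by blast
      have "\<bar>(x - k0) $ i\<bar> \<le> \<bar>(x - k) $ i\<bar>"
        using round_diff_minimal[of "x $ i" m] by (simp add: k0_def m)
      also have "\<dots> \<le> infnorm (x - k)"
        by (rule component_le_infnorm_cart)
      finally show ?thesis .
    qed
    then show ?thesis
      unfolding infnorm_cart[of "x - k0"] by (intro cSup_least) auto
  qed
  have eq: "torus_norm x = infnorm (x - k0)"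
    unfolding torus_norm_def by (rule cInf_eq_minimum) (use k0 min in auto)
  show "\<exists>k. (\<forall>i. k $ i \<in> \<int>) \<and> torus_norm x = infnorm (x - k)"
    using k0 eq by blast
  show "torus_norm x \<le> infnorm (x - k)" if "\<forall>i. k $ i \<in> \<int>" for k
    using eq min[OF that] by simp
qed

text \<open>
  Linear independence over the rationals of the family \<open>1, \<alpha>\<^sub>1, \<dots>, \<alpha>\<^sub>d\<close>. It is spelled out
  because the library's \<open>module.independent\<close> is a predicate on sets, which ignores
  repetitions in a family.
\<close>

definition rationally_independent_with_one :: "real ^ 'd::finite \<Rightarrow> bool" where
  "rationally_independent_with_one \<alpha> \<longleftrightarrow>
     (\<forall>(q\<^sub>0::rat) (q::'d \<Rightarrow> rat).
        of_rat q\<^sub>0 * 1 + (\<Sum>i\<in>UNIV. of_rat (q i) * \<alpha> $ i) = 0 \<longrightarrow> q\<^sub>0 = 0 \<and> (\<forall>i. q i = 0))"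

definition nonsingular_frequencies :: "(real ^ 'd::finite) set" where
  "nonsingular_frequencies =
     {\<alpha>. rationally_independent_with_one \<alpha> \<and>
       (\<exists>c\<^sub>0 > 0. \<exists>N :: nat \<Rightarrow> nat.
          (\<forall>j. N j > 0) \<and> filterlim N at_top sequentially \<and>
          (\<forall>j. Min ((\<lambda>n. torus_norm (real n *\<^sub>R \<alpha>)) ` {1..N j})
                 \<ge> c\<^sub>0 * real (N j) powr (- 1 / real CARD('d))))}"

end

theory Submission
  imports Defs
begin

text \<open>
  In the cube \<open>[-M, M]\<^sup>d\<close>, the points \<open>\<alpha>\<close> with \<open>\<parallel>n\<alpha>\<parallel> < \<epsilon>\<close> are covered by the cubes of radius
  \<open>\<epsilon>/n\<close> about the points \<open>k/n\<close>. There are \<open>O(n\<^sup>d)\<close> relevant \<open>k\<close>, so the measure is \<open>O(\<epsilon>\<^sup>d)\<close>,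
  uniformly in \<open>n\<close>. With \<open>\<epsilon> = c N\<^bsup>-1/d\<^esup>\<close>, summing over \<open>n \<le> N\<close> gives \<open>O(c\<^sup>d)\<close>, uniformly in \<open>N\<close>.
  If no sequence \<open>N\<^sub>j\<close> works for the constant \<open>c\<close>, then \<open>\<alpha>\<close> lies in these exceptional sets for all
  large \<open>N\<close>, hence in a set of measure \<open>O(c\<^sup>d)\<close>; let \<open>c \<rightarrow> 0\<close>. Rational dependence only
  removes countably many hyperplanes.
\<close>

section \<open>Covers of the exceptional sets\<close>

lemma cube_torus_norm_less_cover:
  fixes M n :: nat and \<epsilon> :: real
  assumes n: "n \<ge> 1" and \<epsilon>: "0 < \<epsilon>" "\<epsilon> \<le> 1"
  obtains T :: "(real ^ 'd::finite) set"
  where "T \<in> lmeasurable"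
    and "{\<alpha>. (\<forall>i. \<bar>\<alpha> $ i\<bar> \<le> real M) \<and> torus_norm (real n *\<^sub>R \<alpha>) < \<epsilon>} \<subseteq> T"
    and "measure lebesgue T \<le> (2 * (2 * real M + 3) * \<epsilon>) ^ CARD('d)"
proof -
  \<comment> \<open>If \<open>n * \<alpha> $ i\<close> is within \<open>\<epsilon>\<close> of an
    integer \<open>k i\<close>, then \<open>\<bar>k i\<bar> \<le> n * M + 1\<close>, because
    \<open>\<epsilon> \<le> 1\<close>. So each coordinate has 2nM + 3 candidates.\<close>
  define K where "K = (PiE UNIV (\<lambda>_. {-(int n * int M + 1)..int n * int M + 1}) :: ('d \<Rightarrow> int) set)"
  define Q where "Q k = cbox (\<chi> i. (of_int (k i) - \<epsilon>) / real n) (\<chi> i. (of_int (k i) + \<epsilon>) / real n)"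
    for k :: "'d \<Rightarrow> int"
  have n0: "real n > 0" using n by simp
  have fin: "finite K" unfolding K_def by (intro finite_PiE) auto
  have cardK: "real (card K) = (2 * real n * real M + 3) ^ CARD('d)"
  proof -
    have "real (nat (3 + 2 * (int n * int M))) = 2 * real n * real M + 3"
      by simp
    then show ?thesis
      unfolding K_def by (simp add: card_PiE algebra_simps)
  qed
  have measQ: "measure lebesgue (Q k) = (2 * \<epsilon> / real n) ^ CARD('d)" for k
  proof -
    have "Q k \<noteq> {}"
      using \<epsilon> n0 by (auto simp: Q_def interval_ne_empty_cart divide_right_mono)
    then show ?thesis
      unfolding Q_def
      by (simp add: content_cbox_cart diff_divide_distrib[symmetric])
  qed
  show thesis
  proof (rule that)
    show "(\<Union>k\<in>K. Q k) \<in> lmeasurable"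
      using fin by (intro fmeasurable.finite_UN) (auto simp: Q_def)
    show "{\<alpha>. (\<forall>i. \<bar>\<alpha> $ i\<bar> \<le> real M) \<and> torus_norm (real n *\<^sub>R \<alpha>) < \<epsilon>} \<subseteq> (\<Union>k\<in>K. Q k)"
    proof clarify
      fix \<alpha> :: "real ^ 'd"
      assume M: "\<forall>i. \<bar>\<alpha> $ i\<bar> \<le> real M" and less: "torus_norm (real n *\<^sub>R \<alpha>) < \<epsilon>"
      \<comment> \<open>The infimum in \<open>torus_norm\<close> is attained, so the strict bound
        yields an actual integer point \<open>l\<close>.\<close>
      obtain l where l: "\<forall>i. l $ i \<in> \<int>" "infnorm (real n *\<^sub>R \<alpha> - l) < \<epsilon>"
        using torus_norm_attained(1)[of "real n *\<^sub>R \<alpha>"] less by auto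
      have "\<forall>i. \<exists>m. l $ i = of_int m"
        using l(1) Ints_cases by blast
      then obtain k where k: "\<And>i. l $ i = of_int (k i)"
        by metis
      have near: "\<bar>real n * \<alpha> $ i - of_int (k i)\<bar> < \<epsilon>" for i
        using component_le_infnorm_cart[of "real n *\<^sub>R \<alpha> - l" i] l(2) by (simp add: k)
      have "k i \<in> {-(int n * int M + 1)..int n * int M + 1}" for i
      proof -
        have "\<bar>real n * \<alpha> $ i\<bar> \<le> real n * real M"
          using M by (simp add: abs_mult mult_left_mono)
        then have "\<bar>real_of_int (k i)\<bar> \<le> real n * real M + 1"
          using near[of i] \<epsilon> by linarith
        then have "real_of_int \<bar>k i\<bar> \<le> real_of_int (int n * int M + 1)"
          by simp
        then have "\<bar>k i\<bar> \<le> int n * int M + 1"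
          by (simp only: of_int_le_iff)
        then show ?thesis
          by (simp add: abs_le_iff)
      qed
      then have "k \<in> K"
        unfolding K_def by blast
      moreover have "\<alpha> \<in> Q k"
      proof -
        have "(of_int (k i) - \<epsilon>) / real n \<le> \<alpha> $ i \<and> \<alpha> $ i \<le> (of_int (k i) + \<epsilon>) / real n" for i
          using near[of i] n0 by (simp add: field_simps abs_less_iff)
        then show ?thesis
          by (simp add: Q_def mem_box_cart)
      qed
      ultimately show "\<alpha> \<in> (\<Union>k\<in>K. Q k)"
        by blast
    qed
    have "measure lebesgue (\<Union>k\<in>K. Q k) \<le> (\<Sum>k\<in>K. measure lebesgue (Q k))"
      using fin by (intro measure_UNION_le) (auto simp: Q_def)
    also have "\<dots> = ((2 * real n * real M + 3) * (2 * \<epsilon> / real n)) ^ CARD('d)"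
      by (simp add: measQ cardK flip: power_mult_distrib)
    also have "\<dots> \<le> (2 * (2 * real M + 3) * \<epsilon>) ^ CARD('d)"
    proof (rule power_mono)
      \<comment> \<open>Here 3 \<le> 3n, so the number of candidates per coordinate is linear in n
        and cancels the 1/n in the side length. This makes the bound uniform in n.\<close>
      have "2 * real n * real M + 3 \<le> (2 * real M + 3) * real n"
        using n by (simp add: algebra_simps)
      then have "(2 * real n * real M + 3) * (2 * \<epsilon> / real n)
          \<le> ((2 * real M + 3) * real n) * (2 * \<epsilon> / real n)"
        using \<epsilon> by (intro mult_right_mono) auto
      then show "(2 * real n * real M + 3) * (2 * \<epsilon> / real n) \<le> 2 * (2 * real M + 3) * \<epsilon>"
        using n0 by (simp add: mult_ac)
      show "0 \<le> (2 * real n * real M + 3) * (2 * \<epsilon> / real n)"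
        using \<epsilon> by simp
    qed
    finally show "measure lebesgue (\<Union>k\<in>K. Q k) \<le> (2 * (2 * real M + 3) * \<epsilon>) ^ CARD('d)" .
  qed
qed

text \<open>The exponent -1/d is chosen so that \<open>\<epsilon> ^ d\<close> equals
  \<open>c ^ d / N\<close>: the N covers, one for each n, have total measure free of N. Working with
  a measurable cover avoids any measurability question about \<open>torus_norm\<close>.\<close>

lemma cube_Dirichlet_improvable_cover:
  fixes M N :: nat and c :: real
  assumes N: "N \<ge> 1" and c: "0 < c" "c \<le> 1"
  obtains T :: "(real ^ 'd::finite) set"
  where "T \<in> lmeasurable"
    and "{\<alpha>. (\<forall>i. \<bar>\<alpha> $ i\<bar> \<le> real M) \<and>
           (\<exists>n\<in>{1..N}. torus_norm (real n *\<^sub>R \<alpha>) < c * real N powr (- 1 / real CARD('d)))} \<subseteq> T"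
    and "measure lebesgue T \<le> (2 * (2 * real M + 3) * c) ^ CARD('d)"
proof -
  define \<epsilon> where "\<epsilon> = c * real N powr (- 1 / real CARD('d))"
  have "real N powr (- 1 / real CARD('d)) \<le> 1"
    using N powr_mono[of "- 1 / real CARD('d)" 0 "real N"] by simp
  then have \<epsilon>: "0 < \<epsilon>" "\<epsilon> \<le> 1"
    using N c by (auto simp: \<epsilon>_def intro: mult_le_one)
  have \<epsilon>_pow: "\<epsilon> ^ CARD('d) = c ^ CARD('d) / real N"
  proof -
    have "(real N powr (- 1 / real CARD('d))) ^ CARD('d) = 1 / real N"
      using N powr_power[of "real N" "- 1 / real CARD('d)" "CARD('d)"]
      by (simp add: powr_minus divide_inverse)
    then show ?thesis
      by (simp add: \<epsilon>_def power_mult_distrib)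
  qed
  define A where "A n = {\<alpha> :: real ^ 'd. (\<forall>i. \<bar>\<alpha> $ i\<bar> \<le> real M) \<and> torus_norm (real n *\<^sub>R \<alpha>) < \<epsilon>}"
    for n :: nat
  have "\<exists>T :: (real ^ 'd) set. T \<in> lmeasurable \<and> A n \<subseteq> T \<and>
      measure lebesgue T \<le> (2 * (2 * real M + 3) * \<epsilon>) ^ CARD('d)" if "n \<in> {1..N}" for n
  proof -
    have "n \<ge> 1"
      using that by simp
    then show ?thesis
      by (rule cube_torus_norm_less_cover[OF _ \<epsilon>, where 'd = 'd and M = M]) (unfold A_def, blast)
  qed
  then obtain T :: "nat \<Rightarrow> (real ^ 'd) set" where T:
    "\<And>n. n \<in> {1..N} \<Longrightarrow> T n \<in> lmeasurable"
    "\<And>n. n \<in> {1..N} \<Longrightarrow> A n \<subseteq> T n"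
    "\<And>n. n \<in> {1..N} \<Longrightarrow> measure lebesgue (T n) \<le> (2 * (2 * real M + 3) * \<epsilon>) ^ CARD('d)"
    by metis
  show thesis
  proof (rule that)
    show "(\<Union>n\<in>{1..N}. T n) \<in> lmeasurable"
      using T(1) by (intro fmeasurable.finite_UN) auto
    show "{\<alpha>. (\<forall>i. \<bar>\<alpha> $ i\<bar> \<le> real M) \<and>
           (\<exists>n\<in>{1..N}. torus_norm (real n *\<^sub>R \<alpha>) < c * real N powr (- 1 / real CARD('d)))}
        \<subseteq> (\<Union>n\<in>{1..N}. T n)"
      using T(2) unfolding A_def \<epsilon>_def by blast
    have "measure lebesgue (\<Union>n\<in>{1..N}. T n) \<le> (\<Sum>n\<in>{1..N}. measure lebesgue (T n))"
      using T(1) by (intro measure_UNION_le) auto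
    also have "\<dots> \<le> (\<Sum>n\<in>{1..N}. (2 * (2 * real M + 3) * \<epsilon>) ^ CARD('d))"
      by (intro sum_mono T(3))
    also have "\<dots> = (2 * (2 * real M + 3) * c) ^ CARD('d)"
      using N by (simp add: power_mult_distrib \<epsilon>_pow)
    finally show "measure lebesgue (\<Union>n\<in>{1..N}. T n) \<le> (2 * (2 * real M + 3) * c) ^ CARD('d)" .
  qed
qed

section \<open>Singular vectors are negligible\<close>

text \<open>The set is the increasing union of the tail intersections \<open>F m\<close>. Each lies
  in \<open>E m\<close>, so continuity from below preserves the bound \<open>B\<close>. No
  summability over n is required.\<close>

lemma measure_eventually_le:
  fixes E :: "nat \<Rightarrow> 'a::euclidean_space set"
  assumes E: "\<And>n. E n \<in> lmeasurable" and le: "\<And>n. measure lebesgue (E n) \<le> B"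
  shows "{x. \<forall>\<^sub>F n in sequentially. x \<in> E n} \<in> lmeasurable"
    and "measure lebesgue {x. \<forall>\<^sub>F n in sequentially. x \<in> E n} \<le> B"
proof -
  define F where "F m = (\<Inter>n\<in>{m..}. E n)" for m
  have eq: "{x. \<forall>\<^sub>F n in sequentially. x \<in> E n} = (\<Union>m. F m)"
    by (auto simp: F_def eventually_sequentially)
  have F: "F m \<in> lmeasurable" for m
    unfolding F_def using E by (intro fmeasurable_INT[where i = m]) (auto simp: fmeasurableD)
  have F_le: "measure lebesgue (F m) \<le> B" for m
  proof -
    have "measure lebesgue (F m) \<le> measure lebesgue (E m)"
      using F E by (intro measure_mono_fmeasurable) (auto simp: F_def fmeasurableD)
    with le show ?thesis
      by (rule order_trans[rotated])
  qed
  have mono: "F m \<subseteq> F (Suc m)" for m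
    by (auto simp: F_def)
  show "{x. \<forall>\<^sub>F n in sequentially. x \<in> E n} \<in> lmeasurable"
    unfolding eq by (rule measurable_nested_Union[where S = F, OF F F_le mono])
  show "measure lebesgue {x. \<forall>\<^sub>F n in sequentially. x \<in> E n} \<le> B"
    unfolding eq using F_le
    by (intro LIMSEQ_le_const2[OF measure_nested_Union[where S = F, OF F F_le mono]]) auto
qed

text \<open>These are the singular vectors of Diophantine approximation: the constant in Dirichlet's
  theorem can be made arbitrarily small for all large N. Rational points are included.\<close>

definition singular_vector :: "real ^ 'd::finite \<Rightarrow> bool" where
  "singular_vector \<alpha> \<longleftrightarrow> (\<forall>c>0. \<forall>\<^sub>F N in sequentially.
     \<exists>n\<in>{1..N}. torus_norm (real n *\<^sub>R \<alpha>) < c * real N powr (- 1 / real CARD('d)))"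

lemma negligible_singular_vectors_cube:
  "negligible {\<alpha> :: real ^ 'd::finite. (\<forall>i. \<bar>\<alpha> $ i\<bar> \<le> real M) \<and> singular_vector \<alpha>}"
  unfolding negligible_outer_le
proof (intro allI impI)
  fix e :: real assume "e > 0"
  \<comment> \<open>With this choice the covering bound is \<open>min 1 e\<close> to the power d.
    The minimum with 1 gives \<open>c \<le> 1\<close> and, as d \<ge> 1, keeps that power below
    \<open>e\<close>.\<close>
  define c where "c = min 1 e / (2 * (2 * real M + 3))"
  have c: "0 < c" "c \<le> 1"
    using \<open>e > 0\<close> by (auto simp: c_def divide_le_eq)
  define A where "A N = {\<alpha> :: real ^ 'd. (\<forall>i. \<bar>\<alpha> $ i\<bar> \<le> real M) \<and>
      (\<exists>n\<in>{1..N}. torus_norm (real n *\<^sub>R \<alpha>) < c * real N powr (- 1 / real CARD('d)))}" for N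
  \<comment> \<open>The covering lemma needs N \<ge> 1; the shift to \<open>Suc N\<close> gives a
    cover for every index and does not affect eventual statements.\<close>
  have "\<exists>T. T \<in> lmeasurable \<and> A (Suc N) \<subseteq> T \<and>
      measure lebesgue T \<le> (2 * (2 * real M + 3) * c) ^ CARD('d)" for N
  proof -
    have "Suc N \<ge> 1"
      by simp
    then show ?thesis
      by (rule cube_Dirichlet_improvable_cover[OF _ c, where 'd = 'd and M = M]) (unfold A_def, blast)
  qed
  then obtain T :: "nat \<Rightarrow> (real ^ 'd) set" where T:
    "\<And>N. T N \<in> lmeasurable"
    "\<And>N. A (Suc N) \<subseteq> T N"
    "\<And>N. measure lebesgue (T N) \<le> (2 * (2 * real M + 3) * c) ^ CARD('d)"
    by metis
  let ?L = "{\<alpha>. \<forall>\<^sub>F N in sequentially. \<alpha> \<in> T N}"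
  have "{\<alpha>. (\<forall>i. \<bar>\<alpha> $ i\<bar> \<le> real M) \<and> singular_vector \<alpha>} \<subseteq> ?L"
  proof clarify
    fix \<alpha> :: "real ^ 'd"
    assume M: "\<forall>i. \<bar>\<alpha> $ i\<bar> \<le> real M" and "singular_vector \<alpha>"
    then have "\<forall>\<^sub>F N in sequentially. \<alpha> \<in> A N"
      using c by (simp add: singular_vector_def A_def)
    then have "\<forall>\<^sub>F N in sequentially. \<alpha> \<in> A (Suc N)"
      by (subst eventually_sequentially_Suc)
    then show "\<forall>\<^sub>F N in sequentially. \<alpha> \<in> T N"
      by (rule eventually_mono) (use T(2) in blast)
  qed
  moreover have "(2 * (2 * real M + 3) * c) ^ CARD('d) \<le> e"
  proof -
    have eq: "2 * (2 * real M + 3) * c = min 1 e"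
      by (simp add: c_def)
    have "min 1 e ^ CARD('d) \<le> min 1 e ^ 1"
      using \<open>e > 0\<close> by (intro power_decreasing) (auto simp: Suc_leI)
    then show ?thesis
      unfolding eq by simp
  qed
  ultimately show "\<exists>T. {\<alpha> :: real ^ 'd. (\<forall>i. \<bar>\<alpha> $ i\<bar> \<le> real M) \<and> singular_vector \<alpha>} \<subseteq> T \<and>
      T \<in> lmeasurable \<and> measure lebesgue T \<le> e"
    using measure_eventually_le[OF T(1,3)] by (meson order_trans)
qed

lemma negligible_singular_vectors: "negligible {\<alpha> :: real ^ 'd::finite. singular_vector \<alpha>}"
proof -
  have "\<exists>M::nat. \<forall>i. \<bar>\<alpha> $ i\<bar> \<le> real M" for \<alpha> :: "real ^ 'd"
    using component_le_infnorm_cart[of \<alpha>] real_arch_simple[of "infnorm \<alpha>"] order_trans by blast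
  then have "{\<alpha> :: real ^ 'd. singular_vector \<alpha>} =
      (\<Union>M. {\<alpha>. (\<forall>i. \<bar>\<alpha> $ i\<bar> \<le> real M) \<and> singular_vector \<alpha>})"
    by blast
  then show ?thesis
    using negligible_singular_vectors_cube by auto
qed

section \<open>Rationally dependent vectors\<close>

lemma negligible_rationally_dependent:
  "negligible {\<alpha> :: real ^ 'd::finite. \<not> rationally_independent_with_one \<alpha>}"
proof -
  define H where "H = (\<lambda>(q\<^sub>0::rat, q::'d \<Rightarrow> rat).
    {\<alpha> :: real ^ 'd. (\<chi> i. of_rat (q i)) \<bullet> \<alpha> = - of_rat q\<^sub>0})"
  have "negligible (\<Union>(H ` {p. p \<noteq> (0, \<lambda>_. 0)}))"
  proof (rule negligible_countable_Union)
    fix S assume "S \<in> H ` {p. p \<noteq> (0, \<lambda>_. 0)}"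
    then obtain q\<^sub>0 q where S: "S = H (q\<^sub>0, q)" and nz: "q\<^sub>0 \<noteq> 0 \<or> q \<noteq> (\<lambda>_. 0)"
      by auto
    \<comment> \<open>If \<open>q\<close> vanishes, then \<open>q\<^sub>0\<close> does not and
      \<open>H\<close> is empty rather than a hyperplane; \<open>negligible_hyperplane\<close>
      covers both cases.\<close>
    have "(\<chi> i. real_of_rat (q i)) \<noteq> 0 \<or> - real_of_rat q\<^sub>0 \<noteq> 0"
      using nz by (auto simp: vec_eq_iff fun_eq_iff)
    then show "negligible S"
      unfolding S H_def using negligible_hyperplane by auto
  qed auto
  moreover have "{\<alpha>. \<not> rationally_independent_with_one \<alpha>} \<subseteq> \<Union>(H ` {p. p \<noteq> (0, \<lambda>_. 0)})"
  proof clarify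
    fix \<alpha> :: "real ^ 'd"
    assume "\<not> rationally_independent_with_one \<alpha>"
    then obtain q\<^sub>0 q where "of_rat q\<^sub>0 + (\<Sum>i\<in>UNIV. of_rat (q i) * \<alpha> $ i) = 0"
      "\<not> (q\<^sub>0 = 0 \<and> (\<forall>i. q i = 0))"
      unfolding rationally_independent_with_one_def by auto
    then have "\<alpha> \<in> H (q\<^sub>0, q)" "(q\<^sub>0, q) \<noteq> (0, \<lambda>_. 0)"
      by (auto simp: H_def inner_vec_def)
    then show "\<alpha> \<in> \<Union>(H ` {p. p \<noteq> (0, \<lambda>_. 0)})"
      by blast
  qed
  ultimately show ?thesis
    by (rule negligible_subset)
qed

section \<open>From non-singular vectors to the theorem\<close>

text \<open>Negating singularity gives one constant \<open>c\<close> for which the lower bound holds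
  at infinitely many N; their increasing enumeration is the sequence N_j.\<close>

lemma nonsingular_frequenciesI:
  fixes \<alpha> :: "real ^ 'd::finite"
  assumes "rationally_independent_with_one \<alpha>" and "\<not> singular_vector \<alpha>"
  shows "\<alpha> \<in> nonsingular_frequencies"
proof -
  obtain c where c: "c > 0" and freq: "\<exists>\<^sub>F N in sequentially.
      \<not> (\<exists>n\<in>{1..N}. torus_norm (real n *\<^sub>R \<alpha>) < c * real N powr (- 1 / real CARD('d)))"
    using assms(2) by (auto simp: singular_vector_def not_eventually)
  \<comment> \<open>N = 0 satisfies the second condition vacuously. Excluding it makes every N_j
    positive and the range of the minimum nonempty.\<close>
  define S where "S = {N. N > 0 \<and>
      \<not> (\<exists>n\<in>{1..N}. torus_norm (real n *\<^sub>R \<alpha>) < c * real N powr (- 1 / real CARD('d)))}"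
  have "\<exists>\<^sub>F N in sequentially. N \<in> S"
    using frequently_eventually_frequently[OF freq eventually_gt_at_top[of 0]]
    by (simp add: S_def conj_commute)
  then have S: "infinite S"
    by (simp add: frequently_cofinite flip: cofinite_eq_sequentially)
  let ?N = "enumerate S"
  have N: "?N j \<in> S" for j
    using S by (rule enumerate_in_set)
  have "\<forall>j. Min ((\<lambda>n. torus_norm (real n *\<^sub>R \<alpha>)) ` {1..?N j})
      \<ge> c * real (?N j) powr (- 1 / real CARD('d))"
  proof
    fix j
    have "{1..?N j} \<noteq> {}"
      using N[of j] by (simp add: S_def Suc_le_eq)
    then show "Min ((\<lambda>n. torus_norm (real n *\<^sub>R \<alpha>)) ` {1..?N j})
        \<ge> c * real (?N j) powr (- 1 / real CARD('d))"
      using N[of j] by (subst Min_ge_iff) (auto simp: S_def not_less)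
  qed
  moreover have "filterlim ?N at_top sequentially"
    using S by (intro filterlim_subseq strict_mono_enumerate)
  moreover have "\<forall>j. ?N j > 0"
    using N by (simp add: S_def)
  ultimately show ?thesis
    using assms(1) c unfolding nonsingular_frequencies_def by blast
qed

theorem theoremA1:
  shows "UNIV - (nonsingular_frequencies :: (real ^ 'd::finite) set) \<in> null_sets lebesgue"
proof -
  have "UNIV - (nonsingular_frequencies :: (real ^ 'd) set)
      \<subseteq> {\<alpha>. \<not> rationally_independent_with_one \<alpha>} \<union> {\<alpha>. singular_vector \<alpha>}"
    using nonsingular_frequenciesI by blast
  then have "negligible (UNIV - (nonsingular_frequencies :: (real ^ 'd) set))"
    by (rule negligible_subset[rotated])
      (intro negligible_Un negligible_rationally_dependent negligible_singular_vectors)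
  then show ?thesis
    by (simp add: negligible_iff_null_sets)
qed

end
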